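(* Let $n\ge 1$. For any sequent $S$, provability of $S$ in $\mathcal{G}^\infty\mathsf{wGL}_n$ (with or without $\mathrm{Cut}$) is equivalent to provability of $S$ in $\mathcal{G}^\infty_{\mathrm{mod}}\mathsf{wGL}_n$ (with or without $\mathrm{Cut}$); that is, the following are equivalent: $\mathcal{G}^\infty\mathsf{wGL}_n\vdash S$; $\mathcal{G}^\infty\mathsf{wGL}_n+\mathrm{Cut}\vdash S$; $\mathcal{G}^\infty_{\mathrm{mod}}\mathsf{wGL}_n\vdash S$; $\mathcal{G}^\infty_{\mathrm{mod}}\mathsf{wGL}_n+\mathrm{Cut}\vdash S$.
   Context: Formulas are built from a countably infinite set $\mathrm{Var}$ of propositional variables by $\phi::=p\mid\bot\mid\phi\to\phi\mid\Box\phi$; $\Box^0\phi:=\phi$, $\Box^{m+1}\phi:=\Box\Box^m\phi$. A sequent $\Gamma\Rightarrow\Delta$ is an ordered pair of finite multisets of formulas. For a finite multiset $\Sigma$, $\Box^m\Sigma$ is obtained by prefixing each element with $\Box^m$, and $\boxdot^n\Sigma$ denotes the multiset $\Box^n\Sigma,\Sigma$. The modal modulus $[\phi]_{\mathrm{mod}}\in\mathbb{Z}/n\mathbb{Z}$ of a formula is defined by $[p]_{\mathrm{mod}}=[\bot]_{\mathrm{mod}}=[\phi_0\to\phi_1]_{\mathrm{mod}}=[0]_n$ and $[\Box\phi_0]_{\mathrm{mod}}=[\phi_0]_{\mathrm{mod}}+[1]_n$. Rules ($p\in\mathrm{Var}$, all multisets arbitrary and finite): (ax) conclude $p,\Gamma\Rightarrow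 p,\Delta$ from no premises; ($\bot$L) conclude $\bot,\Gamma\Rightarrow\Delta$ from no premises; ($\bot$R) from $\Gamma\Rightarrow\Delta$ infer $\Gamma\Rightarrow\bot,\Delta$; ($\to$L) from $\Gamma\Rightarrow\phi,\Delta$ and $\psi,\Gamma\Rightarrow\Delta$ infer $\phi\to\psi,\Gamma\Rightarrow\Delta$; ($\to$R) from $\phi,\Gamma\Rightarrow\psi,\Delta$ infer $\Gamma\Rightarrow\phi\to\psi,\Delta$; ($\Box^{\mathsf{wK4}_n}$) from $\boxdot^n\Sigma\Rightarrow\phi$ infer $\Box\Sigma,\Gamma\Rightarrow\Box\phi,\Delta$; ($\Box^{\mathsf{wK4}_n}_{\mathrm{mod}}$) from $\boxdot^n\Sigma_0,\Box^1\Sigma_1,\ldots,\Box^{n-1}\Sigma_{n-1}\Rightarrow\phi$ infer $\Box^1\Sigma_0,\Box^2\Sigma_1,\ldots,\Box^n\Sigma_{n-1},\Gamma\Rightarrow\Box\phi,\Delta$, where every formula in every $\Sigma_i$ ($i<n$) has modal modulus $[0]_n$; ($\mathrm{Cut}$) from $\Gamma\Rightarrow\Delta,\chi$ and $\chi,\Gamma\Rightarrow\Delta$ infer $\Gamma\Rightarrow\Delta$. $\mathcal{G}^\infty\mathsf{wGL}_n$ has the rules (ax), ($\bot$L), ($\bot$R), ($\to$L), ($\to$R), ($\Box^{\mathsf{wK4}_n}$), and $\mathcal{G}^\infty_{\mathrm{mod}}\mathsf{wGL}_n$ has the same rules with ($\Box^{\mathsf{wK4}_n}_{\mathrm{mod}}$)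 in place of ($\Box^{\mathsf{wK4}_n}$). In each of these calculi (with or without $\mathrm{Cut}$) a proof is a possibly infinite, finitely branching tree, locally correct with respect to the rules, such that every infinite branch passes infinitely often through the premise of an instance of the modal rule of the calculus. *)

theory Defs
  imports Main "HOL-Library.Multiset"
begin

datatype fm = Var nat | Bot | Imp fm fm | Box fm

type_synonym sequent = "fm multiset \<times> fm multiset"

definition boxes :: "nat \<Rightarrow> fm multiset \<Rightarrow> fm multiset" where
  "boxes m \<Sigma> = image_mset (Box ^^ m) \<Sigma>"

definition boxdot :: "nat \<Rightarrow> fm multiset \<Rightarrow> fm multiset" where
  "boxdot n \<Sigma> = boxes n \<Sigma> + \<Sigma>"

(* Elements of Z/nZ are represented by their residues in {0..<n}. *)
primrec modulus :: "nat \<Rightarrow> fm \<Rightarrow> nat" where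
  "modulus n (Var p) = 0"
| "modulus n Bot = 0"
| "modulus n (Imp \<phi> \<psi>) = 0"
| "modulus n (Box \<phi>) = (modulus n \<phi> + 1) mod n"

inductive box_wK4 :: "nat \<Rightarrow> sequent \<Rightarrow> sequent \<Rightarrow> bool" for n :: nat where
  "box_wK4 n (boxdot n \<Sigma>, {#\<phi>#}) (boxes 1 \<Sigma> + \<Gamma>, add_mset (Box \<phi>) \<Delta>)"

inductive box_wK4_mod :: "nat \<Rightarrow> sequent \<Rightarrow> sequent \<Rightarrow> bool" for n :: nat where
  "(\<And>i \<psi>. i < n \<Longrightarrow> \<psi> \<in># \<Sigma> i \<Longrightarrow> modulus n \<psi> = 0) \<Longrightarrow>
   box_wK4_mod n
     (boxdot n (\<Sigma> 0) + (\<Sum>i = 1..<n. boxes i (\<Sigma> i)), {#\<phi>#})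
     ((\<Sum>i<n. boxes (i + 1) (\<Sigma> i)) + \<Gamma>, add_mset (Box \<phi>) \<Delta>)"

datatype rule = Ax | BotL | BotR | ImpL | ImpR | Modal | Cut

(* M relates premise and conclusion of the modal rule of the calculus;
   with_cut tells whether the calculus includes Cut. *)
inductive rule_instance ::
  "(sequent \<Rightarrow> sequent \<Rightarrow> bool) \<Rightarrow> bool \<Rightarrow> rule \<Rightarrow> sequent list \<Rightarrow> sequent \<Rightarrow> bool"
  for M :: "sequent \<Rightarrow> sequent \<Rightarrow> bool" and with_cut :: bool where
  ax: "rule_instance M with_cut Ax [] (add_mset (Var p) \<Gamma>, add_mset (Var p) \<Delta>)"
| botL: "rule_instance M with_cut BotL [] (add_mset Bot \<Gamma>, \<Delta>)"
| botR: "rule_instance M with_cut BotR [(\<Gamma>, \<Delta>)] (\<Gamma>, add_mset Bot \<Delta>)"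
| impL: "rule_instance M with_cut ImpL [(\<Gamma>, add_mset \<phi> \<Delta>), (add_mset \<psi> \<Gamma>, \<Delta>)]
           (add_mset (Imp \<phi> \<psi>) \<Gamma>, \<Delta>)"
| impR: "rule_instance M with_cut ImpR [(add_mset \<phi> \<Gamma>, add_mset \<psi> \<Delta>)]
           (\<Gamma>, add_mset (Imp \<phi> \<psi>) \<Delta>)"
| modal: "M S T \<Longrightarrow> rule_instance M with_cut Modal [S] T"
| cutI: "with_cut \<Longrightarrow> rule_instance M with_cut Cut [(\<Gamma>, add_mset \<chi> \<Delta>), (add_mset \<chi> \<Gamma>, \<Delta>)] (\<Gamma>, \<Delta>)"

(* A codatatype, so trees may be infinitely deep; each node carries its sequent
   and the name of the rule of which it is the conclusion. *)
codatatype ptree = Node (root: sequent) (rule_of: rule) (children: "ptree list")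

coinductive locally_correct :: "(sequent \<Rightarrow> sequent \<Rightarrow> bool) \<Rightarrow> bool \<Rightarrow> ptree \<Rightarrow> bool"
  for M :: "sequent \<Rightarrow> sequent \<Rightarrow> bool" and with_cut :: bool where
  "rule_instance M with_cut (rule_of t) (map root (children t)) (root t) \<Longrightarrow>
   (\<And>u. u \<in> set (children t) \<Longrightarrow> locally_correct M with_cut u) \<Longrightarrow>
   locally_correct M with_cut t"

(* A branch is given by the subtrees rooted at its successive nodes. *)
definition infinite_branch :: "ptree \<Rightarrow> (nat \<Rightarrow> ptree) \<Rightarrow> bool" where
  "infinite_branch t b \<longleftrightarrow> b 0 = t \<and> (\<forall>i. b (Suc i) \<in> set (children (b i)))"

(* b (Suc i) is a premise of the rule instance concluding b i, so the branch is at
   a premise of a modal rule instance at step Suc i iff b i is labelled Modal. *)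
definition progressing :: "ptree \<Rightarrow> bool" where
  "progressing t \<longleftrightarrow> (\<forall>b. infinite_branch t b \<longrightarrow> infinite {i. rule_of (b i) = Modal})"

definition provable :: "(sequent \<Rightarrow> sequent \<Rightarrow> bool) \<Rightarrow> bool \<Rightarrow> sequent \<Rightarrow> bool" where
  "provable M with_cut S \<longleftrightarrow> (\<exists>t. root t = S \<and> locally_correct M with_cut t \<and> progressing t)"

abbreviation "GwGL n \<equiv> provable (box_wK4 n) False"
abbreviation "GwGL_Cut n \<equiv> provable (box_wK4 n) True"
abbreviation "GwGL_mod n \<equiv> provable (box_wK4_mod n) False"
abbreviation "GwGL_mod_Cut n \<equiv> provable (box_wK4_mod n) True"

end

theory Submission
  imports Defs
begin

text \<open>
  All four calculi derive exactly the sequents that hold at every world of every Kripke model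
  whose accessibility relation \<open>R\<close> is conversely well-founded and satisfies
  \<open>R ^^ Suc n \<le> R\<close>.

  \<^bold>\<open>Soundness, with Cut\<close> (\<open>provable_imp_not_refutable\<close>).
  If the root of a proof fails at a world, then every rule passes the failure on to one of its
  premises: a modal rule at an \<open>R\<close>-successor of the world, any other rule at the same world.
  The proof is thus followed along an infinite branch, and as that branch meets a modal rule
  infinitely often, it traces an infinite \<open>R\<close>-chain, which does not exist.

  \<^bold>\<open>Completeness, without Cut\<close> (\<open>not_refutable_imp_provable\<close>).
  It is enough to see that every sequent without a countermodel is the conclusion of some rule
  whose premises have no countermodel either: the tree that unfolds these choices is then
  a proof, since a branch of a cut-free tree cannot avoid the modal rule for long, the other rules
  making sequents smaller. The only case of interest is a sequent
  \<open>\<box>\<Theta>, \<Gamma> \<Rightarrow> \<Delta>\<close> to which no propositional rule applies. If each premise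
  \<open>\<box>\<^sup>n\<Theta>, \<Theta> \<Rightarrow> \<phi>\<close> with \<open>\<box>\<phi>\<close> in \<open>\<Delta>\<close> had a countermodel, these could be
  placed side by side above a new root to give a countermodel of the whole sequent
  (\<open>refutable_glue\<close>). Along such a tree \<open>\<box>\<^sup>n\<Theta>\<close> may give rise to ever larger formulas, which is
  harmless because proofs may be infinite.

  \<^bold>\<open>The modular rule.\<close>
  Its premise keeps \<open>\<box>\<^sup>n\<chi>\<close> only for those \<open>\<chi>\<close> in \<open>\<Theta>\<close> whose modulus is zero. The other
  elements of \<open>\<Theta>\<close> have the form \<open>\<box>\<^sup>i\<psi>\<close> with \<open>1 \<le> i < n\<close>, and such a formula implies
  \<open>\<box>\<^bsup>n+i\<^esup>\<psi>\<close> in the models considered, so both modal rules have premises of the same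
  semantic strength (\<open>modal_complete_wK4_mod\<close>).
\<close>

section \<open>Kripke semantics\<close>

primrec forces :: "('w \<Rightarrow> 'w \<Rightarrow> bool) \<Rightarrow> (nat \<Rightarrow> 'w \<Rightarrow> bool) \<Rightarrow> 'w \<Rightarrow> fm \<Rightarrow> bool" where
  "forces R V w (Var p) \<longleftrightarrow> V p w"
| "forces R V w Bot \<longleftrightarrow> False"
| "forces R V w (Imp \<phi> \<psi>) \<longleftrightarrow> (forces R V w \<phi> \<longrightarrow> forces R V w \<psi>)"
| "forces R V w (Box \<phi>) \<longleftrightarrow> (\<forall>v. R w v \<longrightarrow> forces R V v \<phi>)"

definition refutes :: "('w \<Rightarrow> 'w \<Rightarrow> bool) \<Rightarrow> (nat \<Rightarrow> 'w \<Rightarrow> bool) \<Rightarrow> 'w \<Rightarrow> sequent \<Rightarrow> bool" where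
  "refutes R V w S \<longleftrightarrow>
     (\<forall>\<phi>\<in>#fst S. forces R V w \<phi>) \<and> (\<forall>\<phi>\<in>#snd S. \<not> forces R V w \<phi>)"

definition wGL_frame :: "nat \<Rightarrow> ('w \<Rightarrow> 'w \<Rightarrow> bool) \<Rightarrow> bool" where
  "wGL_frame n R \<longleftrightarrow> R ^^ Suc n \<le> R \<and> wfp R\<inverse>\<inverse>"

text \<open>
  Worlds are lists of formulas because this type can hold, for any family of models indexed by
  formulas, a disjoint copy of each model (by prefixing the index) and a new root (the empty list).
\<close>
definition refutable :: "nat \<Rightarrow> sequent \<Rightarrow> bool" where
  "refutable n S \<longleftrightarrow>
     (\<exists>(R :: fm list \<Rightarrow> fm list \<Rightarrow> bool) V w. wGL_frame n R \<and> refutes R V w S)"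

lemma wGL_frameD:
  assumes "wGL_frame n R" "R w v" "(R ^^ n) v u"
  shows "R w u"
proof -
  have "(R ^^ Suc n) w u"
    using assms(2,3) by (rule relpowp_Suc_I2)
  then show ?thesis
    using assms(1) unfolding wGL_frame_def by blast
qed

lemma forces_Box_power:
  "forces R V w ((Box ^^ m) \<phi>) \<longleftrightarrow> (\<forall>v. (R ^^ m) w v \<longrightarrow> forces R V v \<phi>)"
proof (induction m arbitrary: w)
  case 0
  then show ?case by simp
next
  case (Suc m)
  then show ?case
    by (simp del: relpowp.simps) (meson relpowp_Suc_I2 relpowp_Suc_E2)
qed

lemma in_boxes: "\<phi> \<in># boxes m \<Sigma> \<longleftrightarrow> (\<exists>\<psi>. \<psi> \<in># \<Sigma> \<and> \<phi> = (Box ^^ m) \<psi>)"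
  by (auto simp: boxes_def)

lemma forces_boxes:
  "(\<forall>\<phi>\<in>#boxes m \<Sigma>. forces R V w \<phi>) \<longleftrightarrow>
   (\<forall>v. (R ^^ m) w v \<longrightarrow> (\<forall>\<phi>\<in>#\<Sigma>. forces R V v \<phi>))"
  by (simp add: boxes_def forces_Box_power) blast

text \<open>
  The first \<open>n + 1\<close> of \<open>n + i\<close> steps shrink to one. This is why the modular rule may drop
  \<open>\<box>\<^sup>n\<chi>\<close> for every \<open>\<chi>\<close> of nonzero modulus.
\<close>
lemma forces_Box_power_shift:
  assumes "wGL_frame n R" "i \<ge> 1" "forces R V w ((Box ^^ i) \<psi>)"
  shows "forces R V w ((Box ^^ n) ((Box ^^ i) \<psi>))"
proof -
  have "(R ^^ i) w v" if steps: "(R ^^ (n + i)) w v" for v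
  proof -
    obtain j where i: "i = Suc j"
      using assms(2) by (cases i) auto
    obtain u where u: "(R ^^ Suc n) w u" "(R ^^ j) u v"
      using steps relpowp_add[of "Suc n" j R] unfolding i by auto
    have "R w u"
      using u(1) assms(1) unfolding wGL_frame_def by blast
    then show ?thesis
      using u(2) unfolding i by (rule relpowp_Suc_I2)
  qed
  then have "forces R V w ((Box ^^ (n + i)) \<psi>)"
    using assms(3) by (simp only: forces_Box_power) blast
  then show ?thesis
    by (simp add: funpow_add)
qed

section \<open>Soundness\<close>

text \<open>
  With \<open>modal_complete\<close> below, this is all that the proof needs to know about a modal rule; both
  calculi are instances.
\<close>
definition modal_sound :: "nat \<Rightarrow> (sequent \<Rightarrow> sequent \<Rightarrow> bool) \<Rightarrow> bool" where
  "modal_sound n M \<longleftrightarrow>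
     (\<forall>S T (R :: fm list \<Rightarrow> fm list \<Rightarrow> bool) V w. M S T \<longrightarrow> wGL_frame n R \<longrightarrow> refutes R V w T \<longrightarrow>
        (\<exists>v. R w v \<and> refutes R V v S))"

lemma modal_sound_wK4: "modal_sound n (box_wK4 n)"
  unfolding modal_sound_def
proof (intro allI impI)
  fix S T and R :: "fm list \<Rightarrow> fm list \<Rightarrow> bool" and V w
  assume "box_wK4 n S T" and fr: "wGL_frame n R" and ref: "refutes R V w T"
  from this(1) show "\<exists>v. R w v \<and> refutes R V v S"
  proof cases
    case (1 \<Sigma> \<phi> \<Gamma> \<Delta>)
    from ref 1 obtain v where v: "R w v" "\<not> forces R V v \<phi>"
      by (auto simp: refutes_def)
    have "forces R V w (Box \<psi>)" if "\<psi> \<in># \<Sigma>" for \<psi>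
      using ref that by (simp add: 1 refutes_def boxes_def del: forces.simps)
    then have box: "forces R V u \<psi>" if "\<psi> \<in># \<Sigma>" "R w u" for \<psi> u
      using that by simp
    have "refutes R V v S"
      using v box wGL_frameD[OF fr v(1)]
      by (auto simp: 1 refutes_def boxdot_def in_boxes forces_Box_power)
    with v show ?thesis by blast
  qed
qed

lemma modal_sound_wK4_mod:
  assumes "n \<ge> 1"
  shows "modal_sound n (box_wK4_mod n)"
  unfolding modal_sound_def
proof (intro allI impI)
  fix S T and R :: "fm list \<Rightarrow> fm list \<Rightarrow> bool" and V w
  assume "box_wK4_mod n S T" and fr: "wGL_frame n R" and ref: "refutes R V w T"
  from this(1) show "\<exists>v. R w v \<and> refutes R V v S"
  proof cases
    case (1 \<Sigma> \<phi> \<Gamma> \<Delta>)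
    from ref 1 obtain v where v: "R w v" "\<not> forces R V v \<phi>"
      by (auto simp: refutes_def)
    have box: "forces R V u ((Box ^^ i) \<psi>)" if "i < n" "\<psi> \<in># \<Sigma> i" "R w u" for i \<psi> u
    proof -
      have "Box ((Box ^^ i) \<psi>) \<in># (\<Sum>i<n. boxes (i + 1) (\<Sigma> i))"
        using that by (auto simp: set_mset_sum in_boxes)
      then have "forces R V w (Box ((Box ^^ i) \<psi>))"
        using ref unfolding 1 refutes_def by (simp del: forces.simps)
      then show ?thesis
        using that(3) by simp
    qed
    have box0: "forces R V u \<psi>" if "\<psi> \<in># \<Sigma> 0" "R w u" for \<psi> u
      using box[of 0 \<psi> u] that assms by simp
    have "refutes R V v S"
      using v box box0 wGL_frameD[OF fr v(1)]
      by (auto simp: 1 refutes_def boxdot_def in_boxes forces_Box_power set_mset_sum)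
    with v show ?thesis by blast
  qed
qed

lemma refutes_premise:
  fixes R :: "fm list \<Rightarrow> fm list \<Rightarrow> bool"
  assumes "modal_sound n M" "wGL_frame n R" "rule_instance M c r ps S" "refutes R V w S"
  shows "\<exists>p\<in>set ps. \<exists>v. refutes R V v p \<and> (if r = Modal then R w v else v = w)"
  using assms(3)
proof cases
  case (modal P)
  then obtain v where "R w v" "refutes R V v P"
    using assms unfolding modal_sound_def by blast
  with modal show ?thesis by auto
next
  case (cutI \<Gamma> \<chi> \<Delta>)
  then show ?thesis
    using assms(4) by (cases "forces R V w \<chi>") (auto simp: refutes_def)
qed (use assms(4) in \<open>auto simp: refutes_def\<close>)

text \<open>
  Take the least world, with respect to the converse of \<open>R\<close>, on a branch of failures: from there on
  the branch cannot change worlds, so it passes no further modal rule.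
\<close>
theorem provable_imp_not_refutable:
  assumes sound: "modal_sound n M" and "provable M c S"
  shows "\<not> refutable n S"
proof
  assume "refutable n S"
  then obtain R :: "fm list \<Rightarrow> fm list \<Rightarrow> bool" and V w
    where fr: "wGL_frame n R" and w: "refutes R V w S"
    unfolding refutable_def by blast
  obtain t where t: "root t = S" "locally_correct M c t" "progressing t"
    using assms(2) unfolding provable_def by blast
  define P where "P x \<longleftrightarrow> locally_correct M c (fst x) \<and> refutes R V (snd x) (root (fst x))" for x
  define Q where "Q x y \<longleftrightarrow> fst y \<in> set (children (fst x)) \<and>
      (if rule_of (fst x) = Modal then R (snd x) (snd y) else snd y = snd x)" for x y
  have step: "\<exists>y. P y \<and> Q x y" if "P x" for x
  proof -
    obtain u v where x: "x = (u, v)" by (cases x)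
    have u: "locally_correct M c u" "refutes R V v (root u)"
      using that by (auto simp: P_def x)
    have inst: "rule_instance M c (rule_of u) (map root (children u)) (root u)"
      and ch: "\<And>u'. u' \<in> set (children u) \<Longrightarrow> locally_correct M c u'"
      using u(1) by (auto elim: locally_correct.cases)
    obtain u' v' where "u' \<in> set (children u)" "refutes R V v' (root u')"
      "if rule_of u = Modal then R v v' else v' = v"
      using refutes_premise[OF sound fr inst u(2)] by auto
    then show ?thesis
      by (intro exI[of _ "(u', v')"]) (auto simp: P_def Q_def x ch)
  qed
  have start: "P (t, w)"
    using t w by (simp add: P_def)
  obtain f where f0: "f 0 = (t, w)" and f: "\<And>i. P (f i)" "\<And>i. Q (f i) (f (Suc i))"
  proof -
    have "\<exists>f. \<forall>i. (P (f i) \<and> (i = 0 \<longrightarrow> f i = (t, w))) \<and> Q (f i) (f (Suc i))"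
      by (rule dependent_nat_choice) (use start step in blast)+
    then show thesis
      using that by blast
  qed
  have "infinite_branch t (\<lambda>i. fst (f i))"
    using f0 f(2) by (auto simp: infinite_branch_def Q_def)
  then have inf: "infinite {i. rule_of (fst (f i)) = Modal}"
    using t(3) unfolding progressing_def by blast
  have "wfp R\<inverse>\<inverse>"
    using fr by (simp add: wGL_frame_def)
  then have "wf {(y, x). R x y}"
    by (simp add: wfp_def)
  then obtain z where z: "z \<in> range (\<lambda>i. snd (f i))"
      "\<And>y. (y, z) \<in> {(y, x). R x y} \<Longrightarrow> y \<notin> range (\<lambda>i. snd (f i))"
    by (rule wfE_min[where x = "snd (f 0)" and Q = "range (\<lambda>i. snd (f i))"]) auto
  then obtain k where "z = snd (f k)"
    by blast
  with z(2) have k: "\<not> R (snd (f k)) (snd (f j))" for j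
    by blast
  have const: "snd (f (k + d)) = snd (f k)" for d
  proof (induction d)
    case (Suc d)
    then show ?case
      using f(2)[of "k + d"] k[of "Suc (k + d)"] by (auto simp: Q_def split: if_splits)
  qed simp
  obtain m where "m \<ge> k" "rule_of (fst (f m)) = Modal"
    using inf unfolding finite_nat_set_iff_bounded by (metis mem_Collect_eq not_less)
  moreover from this have "snd (f m) = snd (f k)"
    using const[of "m - k"] by simp
  ultimately show False
    using f(2)[of m] k[of "Suc m"] by (simp add: Q_def)
qed

section \<open>Gluing countermodels\<close>

inductive glue :: "nat \<Rightarrow> fm set \<Rightarrow> (fm \<Rightarrow> fm list \<Rightarrow> fm list \<Rightarrow> bool) \<Rightarrow> (fm \<Rightarrow> fm list) \<Rightarrow>
    fm list \<Rightarrow> fm list \<Rightarrow> bool"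
  for n \<Phi> R w where
  base: "\<phi> \<in> \<Phi> \<Longrightarrow> glue n \<Phi> R w [] (\<phi> # w \<phi>)"
| far: "\<phi> \<in> \<Phi> \<Longrightarrow> (R \<phi> ^^ n) (w \<phi>) v \<Longrightarrow> glue n \<Phi> R w [] (\<phi> # v)"
| copy: "\<phi> \<in> \<Phi> \<Longrightarrow> R \<phi> u v \<Longrightarrow> glue n \<Phi> R w (\<phi> # u) (\<phi> # v)"

lemma glue_ConsE:
  assumes "glue n \<Phi> R w (\<phi> # u) x"
  obtains v where "x = \<phi> # v" "\<phi> \<in> \<Phi>" "R \<phi> u v"
  using assms by (auto elim: glue.cases)

lemma glue_power_Cons:
  assumes "(glue n \<Phi> R w ^^ m) (\<phi> # u) x"
  shows "\<exists>v. x = \<phi> # v \<and> (R \<phi> ^^ m) u v"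
  using assms
proof (induction m arbitrary: x)
  case (Suc m)
  then show ?case
    by (auto elim!: glue_ConsE) (metis glue_ConsE relcomppI)
qed simp

text \<open>
  The root sees the points \<open>w \<phi>\<close> and what lies \<open>n\<close> steps beyond them. This is already closed under
  \<open>n\<close> further steps: \<open>2 n\<close> steps from \<open>w \<phi>\<close> amount to \<open>n\<close> steps, as \<open>n + 1\<close> of them shrink to one.
\<close>
lemma wGL_frame_glue:
  assumes "n \<ge> 1" and fr: "\<And>\<phi>. \<phi> \<in> \<Phi> \<Longrightarrow> wGL_frame n (R \<phi>)"
  shows "wGL_frame n (glue n \<Phi> R w)"
  unfolding wGL_frame_def
proof
  let ?G = "glue n \<Phi> R w"
  show "?G ^^ Suc n \<le> ?G"
  proof (intro predicate2I)
    fix x z assume "(?G ^^ Suc n) x z"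
    then obtain y where y: "?G x y" "(?G ^^ n) y z"
      by (rule relpowp_Suc_E2)
    from y(1) show "?G x z"
    proof cases
      case (base \<phi>)
      then show ?thesis
        using glue_power_Cons y(2) glue.far by blast
    next
      case (far \<phi> v)
      obtain v' where v': "z = \<phi> # v'" "(R \<phi> ^^ n) v v'"
        using glue_power_Cons y(2) far by blast
      obtain m where m: "n = Suc m"
        using assms(1) by (cases n) auto
      obtain a where a: "R \<phi> (w \<phi>) a" "(R \<phi> ^^ m) a v"
        using far(4) unfolding m by (rule relpowp_Suc_E2)
      have "(R \<phi> ^^ (m + n)) a v'"
        using a(2) v'(2) unfolding relpowp_add by blast
      then have "(R \<phi> ^^ (n + m)) a v'"
        by (simp only: add.commute)
      then obtain b where b: "(R \<phi> ^^ n) a b" "(R \<phi> ^^ m) b v'"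
        unfolding relpowp_add by blast
      have "R \<phi> (w \<phi>) b"
        using fr[OF far(3)] a(1) b(1) by (rule wGL_frameD)
      then have "(R \<phi> ^^ n) (w \<phi>) v'"
        using b(2) unfolding m by (rule relpowp_Suc_I2)
      then show ?thesis
        using far v' glue.far by blast
    next
      case (copy \<phi> u v)
      then show ?thesis
        using glue_power_Cons y(2) glue.copy wGL_frameD[OF fr] by blast
    qed
  qed
  have acc_Cons: "Wellfounded.accp ?G\<inverse>\<inverse> (\<phi> # u)" if "\<phi> \<in> \<Phi>" for \<phi> u
  proof -
    have "wfp (R \<phi>)\<inverse>\<inverse>"
      using fr[OF that] by (simp add: wGL_frame_def)
    then show ?thesis
    proof (induction u rule: wfp_induct_rule)
      case (less u)
      show ?case
        by (rule accpI) (blast elim: glue_ConsE intro: less)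
    qed
  qed
  have "Wellfounded.accp ?G\<inverse>\<inverse> x" for x
    by (rule accpI) (blast elim: glue.cases intro: acc_Cons)
  then show "wfp ?G\<inverse>\<inverse>"
    by (simp add: wfp_iff_accp)
qed

lemma forces_glue_Cons:
  assumes "\<phi> \<in> \<Phi>"
  shows "forces (glue n \<Phi> R w) (\<lambda>p x. case x of [] \<Rightarrow> A p | \<phi> # u \<Rightarrow> V \<phi> p u) (\<phi> # u) \<chi>
    \<longleftrightarrow> forces (R \<phi>) (V \<phi>) u \<chi>"
proof (induction \<chi> arbitrary: u)
  case (Box \<chi>)
  then show ?case
    by (auto elim!: glue_ConsE intro: glue.copy assms)
qed auto

text \<open>
  Above the new root, \<open>\<Theta>\<close> holds at the points \<open>w \<phi>\<close>, and at the points \<open>n\<close> steps beyond them because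
  \<open>\<box>\<^sup>n\<Theta>\<close> holds at \<open>w \<phi>\<close>. The root's own valuation is free, so it can make exactly the variables
  in \<open>\<Gamma>\<close> true.
\<close>
lemma refutable_glue:
  assumes n: "n \<ge> 1"
    and \<Gamma>: "\<And>\<chi>. \<chi> \<in># \<Gamma> \<Longrightarrow> \<exists>p. \<chi> = Var p \<and> \<chi> \<notin># \<Delta>"
    and \<Delta>: "\<And>\<chi>. \<chi> \<in># \<Delta> \<Longrightarrow> (\<exists>p. \<chi> = Var p) \<or> (\<exists>\<phi>. \<chi> = Box \<phi>)"
    and ref: "\<And>\<phi>. Box \<phi> \<in># \<Delta> \<Longrightarrow> refutable n (boxdot n \<Theta>, {#\<phi>#})"
  shows "refutable n (boxes 1 \<Theta> + \<Gamma>, \<Delta>)"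
proof -
  define \<Phi> where "\<Phi> = {\<phi>. Box \<phi> \<in># \<Delta>}"
  have "\<forall>\<phi>\<in>\<Phi>. \<exists>R V w. wGL_frame n (R :: fm list \<Rightarrow> fm list \<Rightarrow> bool) \<and>
      refutes R V w (boxdot n \<Theta>, {#\<phi>#})"
    using ref unfolding refutable_def \<Phi>_def by blast
  then obtain R V w where
    fr: "\<And>\<phi>. \<phi> \<in> \<Phi> \<Longrightarrow> wGL_frame n (R \<phi> :: fm list \<Rightarrow> fm list \<Rightarrow> bool)" and
    rf: "\<And>\<phi>. \<phi> \<in> \<Phi> \<Longrightarrow> refutes (R \<phi>) (V \<phi>) (w \<phi>) (boxdot n \<Theta>, {#\<phi>#})"
    by metis
  let ?G = "glue n \<Phi> R w"
  let ?V = "\<lambda>p x. case x of [] \<Rightarrow> Var p \<in># \<Gamma> | \<phi> # u \<Rightarrow> V \<phi> p u"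
  have here: "\<forall>\<chi>\<in>#\<Theta>. forces (R \<phi>) (V \<phi>) (w \<phi>) \<chi>"
    and beyond: "\<forall>v. (R \<phi> ^^ n) (w \<phi>) v \<longrightarrow> (\<forall>\<chi>\<in>#\<Theta>. forces (R \<phi>) (V \<phi>) v \<chi>)"
    and fails: "\<not> forces (R \<phi>) (V \<phi>) (w \<phi>) \<phi>" if "\<phi> \<in> \<Phi>" for \<phi>
    using rf[OF that] unfolding forces_boxes[symmetric] by (auto simp: refutes_def boxdot_def)
  have "forces ?G ?V [] (Box \<chi>)" if "\<chi> \<in># \<Theta>" for \<chi>
    using that here beyond by (auto elim!: glue.cases simp: forces_glue_Cons)
  moreover have "\<not> forces ?G ?V [] (Box \<phi>)" if "Box \<phi> \<in># \<Delta>" for \<phi>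
  proof -
    have "\<phi> \<in> \<Phi>"
      using that by (simp add: \<Phi>_def)
    then show ?thesis
      using glue.base[of \<phi> \<Phi> n R w] fails by (auto simp: forces_glue_Cons)
  qed
  ultimately have "refutes ?G ?V [] (boxes 1 \<Theta> + \<Gamma>, \<Delta>)"
    using \<Gamma> \<Delta> by (force simp: refutes_def in_boxes simp del: forces.simps(4))
  moreover have "wGL_frame n ?G"
    using n fr by (rule wGL_frame_glue)
  ultimately show ?thesis
    unfolding refutable_def by (intro exI conjI)
qed

section \<open>Completeness\<close>

definition modal_complete :: "nat \<Rightarrow> (sequent \<Rightarrow> sequent \<Rightarrow> bool) \<Rightarrow> bool" where
  "modal_complete n M \<longleftrightarrow>
     (\<forall>\<Theta> \<Gamma> \<phi> \<Delta>. \<exists>S. M S (boxes 1 \<Theta> + \<Gamma>, add_mset (Box \<phi>) \<Delta>) \<and>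
        (refutable n S \<longrightarrow> refutable n (boxdot n \<Theta>, {#\<phi>#})))"

lemma modal_complete_wK4: "modal_complete n (box_wK4 n)"
  unfolding modal_complete_def by (blast intro: box_wK4.intros)

lemma modulus_decompose:
  assumes "n \<ge> 1"
  shows "modulus n \<chi> < n \<and> (\<exists>\<psi>. \<chi> = (Box ^^ modulus n \<chi>) \<psi> \<and> modulus n \<psi> = 0)"
proof (induction \<chi>)
  case (Box \<chi>)
  then obtain \<psi> where \<psi>: "\<chi> = (Box ^^ modulus n \<chi>) \<psi>" "modulus n \<psi> = 0"
    and lt: "modulus n \<chi> < n" by blast
  show ?case
  proof (cases "Suc (modulus n \<chi>) = n")
    case True
    then show ?thesis by auto
  next
    case False
    with lt have "modulus n (Box \<chi>) = Suc (modulus n \<chi>)" by simp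
    moreover have "Box \<chi> = (Box ^^ Suc (modulus n \<chi>)) \<psi>"
      using \<psi>(1) by simp
    ultimately show ?thesis
      using \<psi>(2) lt False by (metis Suc_lessI)
  qed
qed (use assms in auto)

lemma mset_modulus_decompose:
  assumes "n \<ge> 1"
  shows "\<exists>\<Sigma>. (\<forall>i<n. \<forall>\<psi>\<in>#\<Sigma> i. modulus n \<psi> = 0) \<and> \<Theta> = (\<Sum>i<n. boxes i (\<Sigma> i))"
proof (induction \<Theta>)
  case empty
  show ?case
    by (intro exI[of _ "\<lambda>_. {#}"]) (simp add: boxes_def)
next
  case (add \<chi> \<Theta>)
  then obtain \<Sigma> where \<Sigma>: "\<forall>i<n. \<forall>\<psi>\<in>#\<Sigma> i. modulus n \<psi> = 0" "\<Theta> = (\<Sum>i<n. boxes i (\<Sigma> i))"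
    by blast
  let ?k = "modulus n \<chi>"
  obtain \<psi> where k: "?k < n" and \<psi>: "\<chi> = (Box ^^ ?k) \<psi>" "modulus n \<psi> = 0"
    using modulus_decompose[OF assms] by blast
  let ?\<Sigma> = "\<Sigma>(?k := add_mset \<psi> (\<Sigma> ?k))"
  have "boxes i (?\<Sigma> i) = (if i = ?k then {#\<chi>#} else {#}) + boxes i (\<Sigma> i)" for i
    using \<psi>(1) by (auto simp: boxes_def)
  then have "(\<Sum>i<n. boxes i (?\<Sigma> i)) = add_mset \<chi> \<Theta>"
    using k \<Sigma>(2) by (simp add: sum.distrib)
  then show ?case
    using \<Sigma>(1) \<psi>(2) by (intro exI[of _ ?\<Sigma>]) auto
qed

text \<open>
  A countermodel of the premise built from the decomposition \<open>\<Sigma>\<close> of \<open>\<Theta>\<close> already makes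
  \<open>\<box>\<^sup>n\<chi>\<close> true for every \<open>\<chi>\<close> in \<open>\<Theta>\<close>: for \<open>\<chi>\<close> in \<open>\<Sigma> 0\<close> it is part of the premise, and for the
  others it follows from \<open>\<chi>\<close> by \<open>forces_Box_power_shift\<close>.
\<close>
lemma modal_complete_wK4_mod:
  assumes "n \<ge> 1"
  shows "modal_complete n (box_wK4_mod n)"
  unfolding modal_complete_def
proof (intro allI)
  fix \<Theta> \<Gamma> :: "fm multiset" and \<phi> :: fm and \<Delta> :: "fm multiset"
  obtain \<Sigma> where mod0: "\<forall>i<n. \<forall>\<psi>\<in>#\<Sigma> i. modulus n \<psi> = 0"
    and \<Theta>: "\<Theta> = (\<Sum>i<n. boxes i (\<Sigma> i))"
    using mset_modulus_decompose[OF assms] by blast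
  let ?S = "(boxdot n (\<Sigma> 0) + (\<Sum>i = 1..<n. boxes i (\<Sigma> i)), {#\<phi>#})"
  have boxes_sum: "boxes 1 (\<Sum>i\<in>I. f i) = (\<Sum>i\<in>I. boxes 1 (f i))" for I :: "nat set" and f
    by (induction I rule: infinite_finite_induct) (auto simp: boxes_def)
  have box\<Theta>: "(\<Sum>i<n. boxes (i + 1) (\<Sigma> i)) = boxes 1 \<Theta>"
    unfolding \<Theta> boxes_sum by (intro sum.cong) (auto simp: boxes_def image_mset.compositionality o_def)
  have "box_wK4_mod n ?S ((\<Sum>i<n. boxes (i + 1) (\<Sigma> i)) + \<Gamma>, add_mset (Box \<phi>) \<Delta>)"
    using mod0 by (intro box_wK4_mod.intros) auto
  then have inst: "box_wK4_mod n ?S (boxes 1 \<Theta> + \<Gamma>, add_mset (Box \<phi>) \<Delta>)"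
    unfolding box\<Theta> .
  have "refutable n (boxdot n \<Theta>, {#\<phi>#})" if ref: "refutable n ?S"
  proof -
    obtain R :: "fm list \<Rightarrow> fm list \<Rightarrow> bool" and V w
      where fr: "wGL_frame n R" and w: "refutes R V w ?S"
      using ref unfolding refutable_def by blast
    have \<Theta>_in: "\<chi> \<in># \<Theta> \<longleftrightarrow> (\<exists>i<n. \<exists>\<psi>. \<psi> \<in># \<Sigma> i \<and> \<chi> = (Box ^^ i) \<psi>)" for \<chi>
      unfolding \<Theta> by (auto simp: set_mset_sum in_boxes)
    have force: "forces R V w ((Box ^^ i) \<psi>) \<and> forces R V w ((Box ^^ n) ((Box ^^ i) \<psi>))"
      if "i < n" "\<psi> \<in># \<Sigma> i" for i \<psi>
    proof (cases "i = 0")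
      case True
      then show ?thesis
        using w that by (auto simp: refutes_def boxdot_def boxes_def)
    next
      case False
      have "(Box ^^ i) \<psi> \<in># (\<Sum>i = 1..<n. boxes i (\<Sigma> i))"
        using that False by (auto simp: set_mset_sum in_boxes intro!: bexI[of _ i])
      then have "forces R V w ((Box ^^ i) \<psi>)"
        using w by (auto simp: refutes_def)
      then show ?thesis
        using forces_Box_power_shift[OF fr] False by simp
    qed
    have "refutes R V w (boxdot n \<Theta>, {#\<phi>#})"
      using w force by (auto simp: refutes_def boxdot_def in_boxes \<Theta>_in)
    then show ?thesis
      using fr unfolding refutable_def by blast
  qed
  with inst show "\<exists>S. box_wK4_mod n S (boxes 1 \<Theta> + \<Gamma>, add_mset (Box \<phi>) \<Delta>) \<and>
      (refutable n S \<longrightarrow> refutable n (boxdot n \<Theta>, {#\<phi>#}))"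
    by blast
qed

lemma separate_boxes: "\<exists>\<Theta> \<Gamma>'. \<Gamma> = boxes 1 \<Theta> + \<Gamma>' \<and> (\<forall>\<psi>. Box \<psi> \<notin># \<Gamma>')"
proof (induction \<Gamma>)
  case empty
  show ?case
    by (intro exI[of _ "{#}"]) (simp add: boxes_def)
next
  case (add \<chi> \<Gamma>)
  then obtain \<Theta> \<Gamma>' where IH: "\<Gamma> = boxes 1 \<Theta> + \<Gamma>'" "\<forall>\<psi>. Box \<psi> \<notin># \<Gamma>'"
    by blast
  show ?case
  proof (cases "\<exists>\<psi>. \<chi> = Box \<psi>")
    case True
    then obtain \<psi> where "\<chi> = Box \<psi>" by blast
    with IH have "add_mset \<chi> \<Gamma> = boxes 1 (add_mset \<psi> \<Theta>) + \<Gamma>'"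
      by (simp add: boxes_def)
    with IH(2) show ?thesis by blast
  next
    case False
    with IH have "add_mset \<chi> \<Gamma> = boxes 1 \<Theta> + add_mset \<chi> \<Gamma>' \<and> (\<forall>\<psi>. Box \<psi> \<notin># add_mset \<chi> \<Gamma>')"
      by auto
    then show ?thesis by blast
  qed
qed

text \<open>The propositional rules are semantically invertible; only the modal one needs gluing.\<close>
lemma not_refutable_step:
  assumes n: "n \<ge> 1" and complete: "modal_complete n M" and S: "\<not> refutable n S"
  shows "\<exists>r ps. rule_instance M False r ps S \<and> (\<forall>p\<in>set ps. \<not> refutable n p)"
proof -
  obtain \<Gamma> \<Delta> where S_eq: "S = (\<Gamma>, \<Delta>)" by (cases S)
  have transfer: "\<not> refutable n T"
    if "\<And>(R :: fm list \<Rightarrow> fm list \<Rightarrow> bool) V w. refutes R V w T \<Longrightarrow> refutes R V w S" for T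
    using that S unfolding refutable_def by blast
  consider (ax) p where "Var p \<in># \<Gamma>" "Var p \<in># \<Delta>"
    | (botL) "Bot \<in># \<Gamma>"
    | (botR) "Bot \<in># \<Delta>"
    | (impL) \<phi> \<psi> where "Imp \<phi> \<psi> \<in># \<Gamma>"
    | (impR) \<phi> \<psi> where "Imp \<phi> \<psi> \<in># \<Delta>"
    | (modal) "\<forall>p. \<not> (Var p \<in># \<Gamma> \<and> Var p \<in># \<Delta>)" "Bot \<notin># \<Gamma>" "Bot \<notin># \<Delta>"
        "\<forall>\<phi> \<psi>. Imp \<phi> \<psi> \<notin># \<Gamma>" "\<forall>\<phi> \<psi>. Imp \<phi> \<psi> \<notin># \<Delta>"
    by blast
  then show ?thesis
  proof cases
    case ax
    then obtain \<Gamma>' \<Delta>' where "S = (add_mset (Var p) \<Gamma>', add_mset (Var p) \<Delta>')"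
      using S_eq by (auto dest!: multi_member_split)
    then show ?thesis
      by (intro exI[of _ Ax] exI[of _ "[]"]) (auto intro: rule_instance.intros)
  next
    case botL
    then obtain \<Gamma>' where "S = (add_mset Bot \<Gamma>', \<Delta>)"
      using S_eq by (auto dest!: multi_member_split)
    then show ?thesis
      by (intro exI[of _ BotL] exI[of _ "[]"]) (auto intro: rule_instance.intros)
  next
    case botR
    then obtain \<Delta>' where S': "S = (\<Gamma>, add_mset Bot \<Delta>')"
      using S_eq by (auto dest!: multi_member_split)
    moreover have "\<not> refutable n (\<Gamma>, \<Delta>')"
      by (rule transfer) (auto simp: S' refutes_def)
    ultimately show ?thesis
      by (intro exI[of _ BotR] exI[of _ "[(\<Gamma>, \<Delta>')]"]) (auto intro: rule_instance.intros)
  next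
    case impL
    then obtain \<Gamma>' where S': "S = (add_mset (Imp \<phi> \<psi>) \<Gamma>', \<Delta>)"
      using S_eq by (auto dest!: multi_member_split)
    moreover have "\<not> refutable n (\<Gamma>', add_mset \<phi> \<Delta>)" "\<not> refutable n (add_mset \<psi> \<Gamma>', \<Delta>)"
      by (rule transfer; auto simp: S' refutes_def)+
    ultimately show ?thesis
      by (intro exI[of _ ImpL] exI[of _ "[(\<Gamma>', add_mset \<phi> \<Delta>), (add_mset \<psi> \<Gamma>', \<Delta>)]"])
        (auto intro: rule_instance.intros)
  next
    case impR
    then obtain \<Delta>' where S': "S = (\<Gamma>, add_mset (Imp \<phi> \<psi>) \<Delta>')"
      using S_eq by (auto dest!: multi_member_split)
    moreover have "\<not> refutable n (add_mset \<phi> \<Gamma>, add_mset \<psi> \<Delta>')"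
      by (rule transfer) (auto simp: S' refutes_def)
    ultimately show ?thesis
      by (intro exI[of _ ImpR] exI[of _ "[(add_mset \<phi> \<Gamma>, add_mset \<psi> \<Delta>')]"])
        (auto intro: rule_instance.intros)
  next
    case modal
    obtain \<Theta> \<Gamma>' where \<Gamma>: "\<Gamma> = boxes 1 \<Theta> + \<Gamma>'" "\<forall>\<psi>. Box \<psi> \<notin># \<Gamma>'"
      using separate_boxes by blast
    have left: "\<exists>p. \<chi> = Var p \<and> \<chi> \<notin># \<Delta>" if "\<chi> \<in># \<Gamma>'" for \<chi>
      using that modal \<Gamma> by (cases \<chi>) auto
    have right: "(\<exists>p. \<chi> = Var p) \<or> (\<exists>\<phi>. \<chi> = Box \<phi>)" if "\<chi> \<in># \<Delta>" for \<chi>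
      using that modal by (cases \<chi>) auto
    obtain \<phi> where \<phi>: "Box \<phi> \<in># \<Delta>" "\<not> refutable n (boxdot n \<Theta>, {#\<phi>#})"
      using refutable_glue[OF n, of \<Gamma>' \<Delta> \<Theta>] left right S unfolding S_eq \<Gamma>(1) by blast
    obtain \<Delta>' where \<Delta>: "\<Delta> = add_mset (Box \<phi>) \<Delta>'"
      using \<phi>(1) by (auto dest: multi_member_split)
    obtain T where T: "M T S" "\<not> refutable n T"
      using complete \<phi>(2) unfolding modal_complete_def S_eq \<Gamma>(1) \<Delta> by blast
    then show ?thesis
      by (intro exI[of _ Modal] exI[of _ "[T]"]) (auto intro: rule_instance.intros)
  qed
qed

primcorec unfold_tree :: "(sequent \<Rightarrow> rule) \<Rightarrow> (sequent \<Rightarrow> sequent list) \<Rightarrow> sequent \<Rightarrow> ptree" where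
  "root (unfold_tree r ps S) = S"
| "rule_of (unfold_tree r ps S) = r S"
| "children (unfold_tree r ps S) = map (unfold_tree r ps) (ps S)"

lemma locally_correct_unfold_tree:
  assumes step: "\<And>S. X S \<Longrightarrow> rule_instance M c (r S) (ps S) S \<and> (\<forall>p\<in>set (ps S). X p)"
    and "X S"
  shows "locally_correct M c (unfold_tree r ps S)"
proof -
  have "\<exists>S. t = unfold_tree r ps S \<and> X S \<Longrightarrow> locally_correct M c t" for t
  proof (coinduction arbitrary: t)
    case locally_correct
    then obtain S where S: "t = unfold_tree r ps S" "X S" by blast
    have "map root (children t) = ps S"
      by (simp add: S(1) comp_def)
    then show ?case
      using step[OF S(2)] by (auto simp: S(1))
  qed
  then show ?thesis
    using assms(2) by blast
qed

text \<open>
  Doubling makes the weight of an implication exceed the total weight of its two parts; the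
  additional 1 makes the removal of \<open>Bot\<close>, which has size 0, count as a decrease.
\<close>
definition weight :: "sequent \<Rightarrow> nat" where
  "weight S = (\<Sum>\<phi>\<in>#fst S. 2 * size \<phi> + 1) + (\<Sum>\<phi>\<in>#snd S. 2 * size \<phi> + 1)"

lemma weight_premise:
  assumes "rule_instance M False r ps S" "r \<noteq> Modal" "p \<in> set ps"
  shows "weight p < weight S"
  using assms by cases (auto simp: weight_def)

text \<open>A branch that is eventually free of modal rules would have strictly decreasing weights.\<close>
lemma cut_free_progressing:
  assumes "locally_correct M False t"
  shows "progressing t"
  unfolding progressing_def
proof (intro allI impI notI)
  fix b assume b: "infinite_branch t b" and fin: "finite {i. rule_of (b i) = Modal}"
  have lc: "locally_correct M False (b i)" for i
  proof (induction i)
    case 0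
    then show ?case using b assms by (simp add: infinite_branch_def)
  next
    case (Suc i)
    moreover have "b (Suc i) \<in> set (children (b i))"
      using b by (simp add: infinite_branch_def)
    ultimately show ?case by (auto elim: locally_correct.cases)
  qed
  obtain k where k: "\<And>i. i \<ge> k \<Longrightarrow> rule_of (b i) \<noteq> Modal"
    using fin unfolding finite_nat_set_iff_bounded by (metis mem_Collect_eq not_less)
  have "weight (root (b (Suc (k + i)))) < weight (root (b (k + i)))" for i
  proof (rule weight_premise)
    show "rule_instance M False (rule_of (b (k + i))) (map root (children (b (k + i)))) (root (b (k + i)))"
      using lc[of "k + i"] by (auto elim: locally_correct.cases)
    show "rule_of (b (k + i)) \<noteq> Modal"
      by (rule k) simp
    show "root (b (Suc (k + i))) \<in> set (map root (children (b (k + i))))"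
      using b by (simp add: infinite_branch_def)
  qed
  then have "\<exists>f :: nat \<Rightarrow> nat. \<forall>i. f (Suc i) < f i"
    by (intro exI[of _ "\<lambda>i. weight (root (b (k + i)))"]) simp
  then show False
    using wf_iff_no_infinite_down_chain[of less_than] by auto
qed

theorem not_refutable_imp_provable:
  assumes "n \<ge> 1" "modal_complete n M" "\<not> refutable n S"
  shows "provable M False S"
proof -
  obtain r ps where "\<And>S. \<not> refutable n S \<Longrightarrow>
      rule_instance M False (r S) (ps S) S \<and> (\<forall>p\<in>set (ps S). \<not> refutable n p)"
    using not_refutable_step[OF assms(1,2)] by metis
  then have "locally_correct M False (unfold_tree r ps S)"
    using assms(3) by (rule locally_correct_unfold_tree)
  then show ?thesis
    unfolding provable_def using cut_free_progressing by (intro exI[of _ "unfold_tree r ps S"]) simp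
qed

section \<open>Equivalence of the four calculi\<close>

lemma provable_iff_not_refutable:
  assumes "n \<ge> 1" "modal_sound n M" "modal_complete n M"
  shows "provable M c S \<longleftrightarrow> \<not> refutable n S"
proof
  assume "\<not> refutable n S"
  then obtain t where t: "root t = S" "locally_correct M False t" "progressing t"
    using not_refutable_imp_provable[OF assms(1,3)] unfolding provable_def by blast
  have "locally_correct M c t"
    using t(2)
  proof (coinduction arbitrary: t)
    case locally_correct
    then have inst: "rule_instance M False (rule_of t) (map root (children t)) (root t)"
      and ch: "\<forall>u\<in>set (children t). locally_correct M False u"
      by (auto elim: locally_correct.cases)
    from inst have "rule_instance M c (rule_of t) (map root (children t)) (root t)"
      by cases (auto intro: rule_instance.intros)
    with ch show ?case by blast
  qed
  with t show "provable M c S"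
    unfolding provable_def by blast
qed (use provable_imp_not_refutable[OF assms(2)] in blast)

theorem mainTheorem4:
  fixes n :: nat and S :: sequent
  assumes "n \<ge> 1"
  shows "(GwGL n S \<longleftrightarrow> GwGL_Cut n S) \<and>
         (GwGL_Cut n S \<longleftrightarrow> GwGL_mod n S) \<and>
         (GwGL_mod n S \<longleftrightarrow> GwGL_mod_Cut n S)"
  using provable_iff_not_refutable[OF assms modal_sound_wK4 modal_complete_wK4]
    provable_iff_not_refutable[OF assms modal_sound_wK4_mod[OF assms] modal_complete_wK4_mod[OF assms]]
  by simp

end
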